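(* Let $\theta$ be a complex Garsia number whose minimal polynomial has constant term $\pm2$, and let $\lambda=1/\theta$. Then $\nu_\lambda$ is absolutely continuous with respect to two-dimensional Lebesgue measure $\mathcal L_2$, with a bounded density.
   Context: An algebraic integer $\theta$ with $|\theta|>1$ is a Garsia number if all its Galois conjugates have modulus greater than one; a complex Garsia number is a non-real Garsia number. $\nu_\lambda$ is the distribution of the random series $\sum_{n\ge0}\pm\lambda^n$ with signs chosen independently with probability $1/2$ each (a probability measure on $\mathbb C\cong\mathbb R^2$). *)

theory Defs
  imports "HOL-Probability.Probability" "HOL-Computational_Algebra.Polynomial"
begin

definition algebraic_integer :: "complex \<Rightarrow> bool" where
  "algebraic_integer z \<longleftrightarrow>
     (\<exists>p :: int poly. lead_coeff p = 1 \<and> poly (map_poly of_int p) z = 0)"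

definition is_min_poly :: "complex \<Rightarrow> rat poly \<Rightarrow> bool" where
  "is_min_poly z p \<longleftrightarrow>
     lead_coeff p = 1 \<and> poly (map_poly of_rat p) z = 0 \<and>
     (\<forall>q :: rat poly. q \<noteq> 0 \<and> poly (map_poly of_rat q) z = 0 \<longrightarrow> degree p \<le> degree q)"

definition galois_conjugates :: "complex \<Rightarrow> complex set" where
  "galois_conjugates z = {w. \<exists>p. is_min_poly z p \<and> poly (map_poly of_rat p) w = 0}"

definition garsia_number :: "complex \<Rightarrow> bool" where
  "garsia_number z \<longleftrightarrow> algebraic_integer z \<and> norm z > 1 \<and>
     (\<forall>w \<in> galois_conjugates z. norm w > 1)"

definition complex_garsia_number :: "complex \<Rightarrow> bool" where
  "complex_garsia_number z \<longleftrightarrow> garsia_number z \<and> z \<notin> \<real>"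

definition sign_space :: "(nat \<Rightarrow> bool) measure" where
  "sign_space = PiM UNIV (\<lambda>_. measure_pmf (bernoulli_pmf (1/2)))"

definition sgn_of :: "bool \<Rightarrow> complex" where
  "sgn_of b = (if b then 1 else -1)"

definition nu :: "complex \<Rightarrow> complex measure" where
  "nu l = distr sign_space borel (\<lambda>\<omega>. \<Sum>n. sgn_of (\<omega> n) * l ^ n)"

end

theory Submission
  imports Defs "Jordan_Normal_Form.Determinant" "Berlekamp_Zassenhaus.Factor_Bound"
begin

text \<open>
  Put \<open>\<lambda> = 1 / \<theta>\<close>. Two distinct sums \<open>\<Sum>k<n. \<plusminus>\<lambda> ^ k\<close> differ by
  \<open>2 * Q(\<theta>) / \<theta> ^ n\<close> for a nonzero polynomial \<open>Q\<close> with coefficients in \<open>{-1, 0, 1}\<close>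
  and degree at most \<open>n\<close>. Because the constant term of the minimal polynomial is not a unit, \<open>Q\<close>
  vanishes at no conjugate, so the norm of \<open>Q(\<theta>)\<close> is a nonzero integer. At a conjugate \<open>w\<close>
  one has \<open>|Q(w)| \<le> K(w) * |w| ^ n\<close>, and the conjugates have product of modulus 2; splitting off
  the two conjugates \<open>\<theta>\<close> and \<open>cnj \<theta>\<close> gives \<open>|Q(\<theta>) / \<theta> ^ n|\<^sup>2 \<ge> c / 2 ^ n\<close>.
  Hence the \<open>2 ^ n\<close> equally likely partial sums are so well separated that comparing areas of disjoint
  discs bounds their distribution by a constant times the area of a neighbourhood. Letting first \<open>n\<close>
  grow and then the neighbourhood shrink yields \<open>\<nu>(K) \<le> C * area(K)\<close> for compact \<open>K\<close>,
  and inner regularity extends this to all Borel sets.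
\<close>

hide_const (open) up_ring.coeff up_ring.monom module.smult Finite_Cartesian_Product.vec
no_notation Finite_Cartesian_Product.vec_nth (infixl "$" 90)

subsection \<open>Integrality of norms\<close>

interpretation of_rat_poly_hom: map_poly_inj_idom_hom "of_rat :: rat \<Rightarrow> complex" ..

section \<open>Divisibility and integrality of the minimal polynomial\<close>

lemma map_poly_of_rat_of_int:
  "map_poly of_rat (map_poly of_int P :: rat poly) = (map_poly of_int P :: 'a :: field_char_0 poly)"
  by (intro poly_eqI) simp

text \<open>Minimality of the degree acts as irreducibility: in \<open>p = g * h\<close> with
  \<open>g = gcd p q\<close>, one factor vanishes at \<open>z\<close> and so has the full degree. By
  Bezout \<open>g\<close> vanishes at \<open>w\<close>, so \<open>g\<close> is not constant and
  \<open>h\<close> is a unit. The root \<open>w\<close> may be any conjugate, not only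
  \<open>z\<close> itself.\<close>

lemma min_poly_dvd_of_common_root:
  fixes p q :: "rat poly"
  assumes p: "is_min_poly z p"
    and pw: "poly (map_poly of_rat p) (w :: complex) = 0"
    and qw: "poly (map_poly of_rat q) w = 0"
  shows "p dvd q"
proof -
  have p0: "p \<noteq> 0" using p by (auto simp: is_min_poly_def)
  define g where "g = gcd p q"
  obtain h where h: "p = g * h" unfolding g_def by (meson dvdE gcd_dvd1)
  have g0: "g \<noteq> 0" and h0: "h \<noteq> 0" using p0 h by auto
  obtain a b where ab: "a * p + b * q = g"
    using bezout_coefficients_fst_snd[of p q] unfolding g_def by blast
  have gw: "poly (map_poly of_rat g) w = 0"
    unfolding ab[symmetric] by (simp add: hom_distribs pw qw)
  have "poly (map_poly of_rat g) z * poly (map_poly of_rat h) z = 0"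
    using p unfolding is_min_poly_def h by (simp add: hom_distribs)
  then consider "poly (map_poly of_rat g) z = 0" | "poly (map_poly of_rat h) z = 0" by auto
  then show ?thesis
  proof cases
    case 1
    then have "degree p \<le> degree g" using p g0 by (auto simp: is_min_poly_def)
    moreover have "degree p = degree g + degree h" using h g0 h0 by (simp add: degree_mult_eq)
    ultimately have "degree h = 0" by simp
    then have "h dvd 1" using h0 by (simp add: is_unit_iff_degree)
    then have "p dvd g" using h by (simp add: mult_unit_dvd_iff)
    then show ?thesis unfolding g_def by (meson dvd_trans gcd_dvd2)
  next
    case 2
    then have "degree p \<le> degree h" using p h0 by (auto simp: is_min_poly_def)
    moreover have "degree p = degree g + degree h" using h g0 h0 by (simp add: degree_mult_eq)
    ultimately have "degree g = 0" by simp
    then obtain c where "g = [:c:]" by (auto elim: degree_eq_zeroE)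
    then show ?thesis using gw g0 by simp
  qed
qed

text \<open>Gauss's lemma: the primitive integer multiple \<open>P\<close> of \<open>p\<close>
  divides a monic integer polynomial over the integers, so its leading coefficient is a
  unit.\<close>

lemma min_poly_integral:
  assumes z: "algebraic_integer z" and p: "is_min_poly z p"
  obtains P :: "int poly" where "p = map_poly of_int P" "lead_coeff P = 1"
proof -
  obtain F :: "int poly" where F: "lead_coeff F = 1" "poly (map_poly of_int F) z = 0"
    using z by (auto simp: algebraic_integer_def)
  have pz: "poly (map_poly of_rat p) z = 0" and lp: "lead_coeff p = 1"
    using p by (auto simp: is_min_poly_def)
  have "p dvd map_poly of_int F"
    by (rule min_poly_dvd_of_common_root[OF p pz]) (simp add: map_poly_of_rat_of_int F)
  then obtain h where h: "map_poly of_int F = p * h" by (elim dvdE)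
  obtain r P where rP: "rat_to_normalized_int_poly p = (r, P)" by fastforce
  have r: "p = smult r (map_poly of_int P)" "r > 0" using rat_to_normalized_int_poly[OF rP] by auto
  obtain s where "F = P * smult (content F) s"
    using rat_to_int_factor_explicit[OF h rP] by auto
  then have "lead_coeff P * lead_coeff (smult (content F) s) = 1" using F(1) by (metis lead_coeff_mult)
  then have unit: "lead_coeff P = 1 \<or> lead_coeff P = -1" using zmult_eq_1_iff by blast
  \<comment> \<open>Positivity of the content \<open>r\<close> rules out the unit -1.\<close>
  have "r * of_int (lead_coeff P) = 1" using lp r(2) unfolding r(1) by simp
  then have "lead_coeff P = 1" "r = 1" using unit \<open>r > 0\<close> by auto
  then show ?thesis using that r by simp
qed

text \<open>A multiple root would be shared with \<open>pderiv p\<close>, and \<open>p\<close> would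
  divide this nonzero polynomial of smaller degree.\<close>

lemma min_poly_rsquarefree:
  assumes p: "is_min_poly z p"
  shows "rsquarefree (map_poly of_rat p :: complex poly)"
  unfolding rsquarefree_roots
proof (intro allI notI, elim conjE)
  fix w :: complex
  assume w: "poly (map_poly of_rat p) w = 0" "poly (pderiv (map_poly of_rat p)) w = 0"
  have p0: "p \<noteq> 0" using p by (auto simp: is_min_poly_def)
  have "degree p \<noteq> 0"
  proof
    assume "degree p = 0"
    then obtain c where "p = [:c:]" by (auto elim: degree_eq_zeroE)
    then show False using w p0 by simp
  qed
  have "p dvd pderiv p"
    by (rule min_poly_dvd_of_common_root[OF p w(1)]) (use w(2) in \<open>simp add: of_rat_hom.map_poly_pderiv\<close>)
  then have "degree p \<le> degree (pderiv p)"
    using \<open>degree p \<noteq> 0\<close> by (intro dvd_imp_degree_le) (auto simp: pderiv_eq_0_iff)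
  then show False using \<open>degree p \<noteq> 0\<close> by (simp add: degree_pderiv)
qed

section \<open>Division by a monic integer polynomial and norms as determinants\<close>

lemma monic_int_division:
  fixes P Q :: "int poly"
  assumes "lead_coeff P = 1" "degree P > 0"
  obtains A B where "Q = P * A + B" "degree B < degree P"
proof -
  \<comment> \<open>Pseudo-division scales the dividend by a power of the leading coefficient, which
    is 1 here.\<close>
  obtain A B where AB: "pseudo_divmod Q P = (A, B)" by fastforce
  have "P \<noteq> 0" using assms by auto
  from pseudo_divmod[OF this AB] show ?thesis using assms that[of A B] by auto
qed

lemma sum_eq_poly_of_degree_less:
  fixes p :: "'a :: comm_semiring_1 poly"
  assumes "degree p < d"
  shows "(\<Sum>k<d. coeff p k * x ^ k) = poly p x"
proof -
  have "poly p x = (\<Sum>k\<le>degree p. coeff p k * x ^ k)" by (rule poly_altdef)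
  also have "\<dots> = (\<Sum>k<d. coeff p k * x ^ k)"
    using assms by (intro sum.mono_neutral_left) (auto simp: coeff_eq_0)
  finally show ?thesis ..
qed

text \<open>
  Multiplication by \<open>Q\<close> modulo \<open>P\<close> has an integer matrix \<open>M\<close> in the monomial basis, and the
  Vandermonde matrix \<open>V\<close> of the distinct roots diagonalises it, so the product is \<open>det M\<close>.
\<close>
lemma prod_roots_poly_Ints:
  fixes P Q :: "int poly"
  assumes monic: "lead_coeff P = 1"
    and sf: "rsquarefree (map_poly of_int P :: complex poly)"
  shows "(\<Prod>w | poly (map_poly of_int P) w = 0. poly (map_poly of_int Q) w) \<in> (\<int> :: complex set)"
proof (cases "degree P = 0")
  case True
  then have "P = 1" using monic by (auto elim!: degree_eq_zeroE)
  then show ?thesis by simp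
next
  case False
  define d where "d = degree P"
  define R where "R = {w :: complex. poly (map_poly of_int P) w = 0}"
  have P0: "(map_poly of_int P :: complex poly) \<noteq> 0" using monic by auto
  have finR: "finite R" unfolding R_def using P0 by (rule poly_roots_finite)
  \<comment> \<open>Squarefreeness gives as many distinct roots as the degree, so that
    \<open>V\<close> below is square.\<close>
  have "(\<Prod>z\<in>R. [:-z, 1:]) = (map_poly of_int P :: complex poly)"
    using complex_poly_decompose_rsquarefree[OF sf] monic unfolding R_def by simp
  moreover have "degree (\<Prod>z\<in>R. [:-z, 1:]) = card R"
    by (simp add: degree_prod_eq_sum_degree)
  ultimately have cardR: "card R = d" unfolding d_def by simp
  obtain r where r: "bij_betw r {..<d} R"
    using finR cardR by (metis bij_betw_from_nat_into_finite)
  \<comment> \<open>The remainder of \<open>x ^ j * Q\<close> modulo \<open>P\<close> supplies row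
    \<open>j\<close> of \<open>M\<close>; evaluated at a root it agrees with the original
    product.\<close>
  have "\<exists>B. degree B < d \<and> (\<forall>w\<in>R. poly (map_poly of_int B) w = w ^ j * poly (map_poly of_int Q) w)" for j
  proof -
    obtain A B where AB: "monom 1 j * Q = P * A + B" "degree B < degree P"
      using monic_int_division[of P] monic False by blast
    have "w ^ j * poly (map_poly of_int Q) w = poly (map_poly of_int B) w" if "w \<in> R" for w
      using arg_cong[OF AB(1), of "\<lambda>q. poly (map_poly of_int q) w"] that
      by (simp add: hom_distribs R_def poly_monom)
    then show ?thesis using AB(2) unfolding d_def by (intro exI[of _ B]) auto
  qed
  then obtain B where B: "\<And>j. degree (B j) < d"
    "\<And>j w. w \<in> R \<Longrightarrow> poly (map_poly of_int (B j)) w = w ^ j * poly (map_poly of_int Q) w"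
    by metis
  define M where "M = Matrix.mat d d (\<lambda>(j, k). coeff (B j) k)"
  define V where "V = Matrix.mat d d (\<lambda>(k, i). r i ^ k)"
  define D where "D = Matrix.mat d d (\<lambda>(k, i). if k = i then poly (map_poly of_int Q) (r i) else 0)"
  define M' where "M' = map_mat complex_of_int M"
  have car: "M \<in> carrier_mat d d" "M' \<in> carrier_mat d d" "V \<in> carrier_mat d d" "D \<in> carrier_mat d d"
    by (auto simp: M_def M'_def V_def D_def)
  have rR: "r i \<in> R" if "i < d" for i using r that by (auto simp: bij_betw_def)
  have "M' * V = V * D"
  proof (rule eq_matI)
    fix j i assume "j < dim_row (V * D)" "i < dim_col (V * D)"
    then have ji: "j < d" "i < d" by (auto simp: V_def D_def)
    have "(M' * V) $$ (j, i) = (\<Sum>k<d. of_int (coeff (B j) k) * r i ^ k)"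
      using ji by (simp add: M'_def M_def V_def scalar_prod_def atLeast0LessThan)
    also have "\<dots> = poly (map_poly of_int (B j)) (r i)"
      using sum_eq_poly_of_degree_less[of "map_poly complex_of_int (B j)" d "r i"] B(1) by simp
    also have "\<dots> = r i ^ j * poly (map_poly of_int Q) (r i)" using B(2) rR ji by blast
    also have "\<dots> = (\<Sum>k<d. if k = i then r i ^ j * poly (map_poly of_int Q) (r i) else 0)"
      using ji by simp
    also have "\<dots> = (\<Sum>k<d. r k ^ j * (if k = i then poly (map_poly of_int Q) (r i) else 0))"
      by (intro sum.cong) auto
    also have "\<dots> = (V * D) $$ (j, i)"
      using ji by (simp add: V_def D_def scalar_prod_def atLeast0LessThan)
    finally show "(M' * V) $$ (j, i) = (V * D) $$ (j, i)" .
  qed (auto simp: M'_def M_def V_def D_def)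
  then have detMV: "Determinant.det M' * Determinant.det V = Determinant.det V * Determinant.det D"
    using det_mult[OF car(2,3)] det_mult[OF car(3,4)] by metis
  have detV: "Determinant.det V \<noteq> 0"
  proof
    assume "Determinant.det V = 0"
    then have "Determinant.det (transpose_mat V) = 0" using det_transpose[OF car(3)] by simp
    then obtain v where v: "v \<in> carrier_vec d" "v \<noteq> 0\<^sub>v d" "transpose_mat V *\<^sub>v v = 0\<^sub>v d"
      using det_0_iff_vec_prod_zero[of "transpose_mat V" d] car(3) by auto
    \<comment> \<open>A kernel vector of the transpose lists the coefficients of a nonzero
      polynomial of degree below \<open>d\<close> with all \<open>d\<close> elements of
      \<open>R\<close> as roots.\<close>
    define f where "f = (\<Sum>k<d. monom (v $ k) k)"
    have cf: "coeff f k = (if k < d then v $ k else 0)" for k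
      by (simp add: f_def coeff_sum if_distrib[of "\<lambda>x. coeff x k"] coeff_monom)
    have f0: "f \<noteq> 0"
    proof
      assume "f = 0"
      then have "v $ k = 0" if "k < d" for k using cf[of k] that by simp
      then have "v = 0\<^sub>v d" using v(1) by (intro eq_vecI) auto
      then show False using v(2) by simp
    qed
    have "poly f (r i) = 0" if "i < d" for i
    proof -
      have "0 = (transpose_mat V *\<^sub>v v) $ i" using v(3) that by simp
      also have "\<dots> = (\<Sum>k<d. r i ^ k * v $ k)"
        using that v(1) by (simp add: V_def scalar_prod_def atLeast0LessThan)
      also have "\<dots> = poly f (r i)"
        by (simp add: f_def poly_sum poly_monom mult.commute)
      finally show ?thesis by simp
    qed
    then have "R \<subseteq> {w. poly f w = 0}" using r by (auto simp: bij_betw_def)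
    then have "d \<le> card {w. poly f w = 0}"
      using card_mono[OF poly_roots_finite[OF f0]] cardR by metis
    also have "\<dots> \<le> degree f" using f0 by (rule card_poly_roots_bound)
    also have "degree f < d"
      using False cf unfolding d_def[symmetric] by (intro degree_lessI) auto
    finally show False by simp
  qed
  have "(\<Prod>w\<in>R. poly (map_poly of_int Q) w) = (\<Prod>i<d. poly (map_poly of_int Q) (r i))"
    by (rule prod.reindex_bij_betw[OF r, symmetric])
  also have "\<dots> = Determinant.det D"
    by (subst det_upper_triangular[OF _ car(4)])
       (auto simp: D_def upper_triangular_def prod_list_diag_prod atLeast0LessThan)
  also have "\<dots> = Determinant.det M'" using detMV detV by simp
  also have "\<dots> = of_int (Determinant.det M)" unfolding M'_def by (rule of_int_hom.hom_det)
  finally show ?thesis unfolding R_def by simp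
qed


section \<open>Separation of the signed sums\<close>

text \<open>A common root would make \<open>P\<close> divide \<open>Q\<close> with its power of
  \<open>x\<close> removed, over the integers. The constant term of the quotiented \<open>Q\<close>
  is 1 or -1, which the constant term of \<open>P\<close> cannot divide.\<close>

lemma poly_nonzero_at_conjugates:
  fixes P Q :: "int poly"
  assumes p: "is_min_poly z (map_poly of_int P)" and monic: "lead_coeff P = 1"
    and P0: "\<bar>coeff P 0\<bar> > 1"
    and Q: "Q \<noteq> 0" "\<And>k. coeff Q k \<in> {-1, 0, 1}"
    and w: "poly (map_poly of_int P) (w :: complex) = 0"
  shows "poly (map_poly of_int Q) w \<noteq> 0"
proof
  assume Qw: "poly (map_poly of_int Q) w = 0"
  have w0: "w \<noteq> 0" using w P0 by (auto simp: poly_0_coeff_0)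
  have deg: "degree P > 0"
  proof (rule ccontr)
    assume "\<not> degree P > 0"
    then have "P = 1" using monic by (auto elim!: degree_eq_zeroE)
    then show False using w by simp
  qed
  have dvd: "map_poly of_int P dvd (map_poly of_int q :: rat poly)"
    if "poly (map_poly of_int q) w = 0" for q
    by (rule min_poly_dvd_of_common_root[OF p, of w]) (auto simp: map_poly_of_rat_of_int w that)
  define n where "n = (LEAST k. coeff Q k \<noteq> 0)"
  have "\<exists>k. coeff Q k \<noteq> 0" using Q(1) by (metis leading_coeff_0_iff)
  then have n: "coeff Q n \<noteq> 0" "\<And>k. k < n \<Longrightarrow> coeff Q k = 0"
    unfolding n_def by (rule LeastI_ex, auto dest: not_less_Least)
  define Q' where "Q' = poly_shift n Q"
  have QQ': "Q = monom 1 n * Q'"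
    by (rule poly_eqI) (auto simp: Q'_def coeff_monom_mult coeff_poly_shift n)
  have Q'w: "poly (map_poly of_int Q') w = 0"
    using Qw w0 unfolding QQ' by (simp add: hom_distribs poly_monom)
  obtain A B where AB: "Q' = P * A + B" "degree B < degree P"
    using monic_int_division[OF monic deg] by blast
  have "poly (map_poly of_int B) w = 0"
    using Q'w w unfolding AB(1) by (simp add: hom_distribs)
  \<comment> \<open>Divisibility is known only over the rationals; dividing with remainder by the
    monic \<open>P\<close> and killing the remainder transfers it to the integers.\<close>
  from dvd_imp_degree_le[OF dvd[OF this]] AB(2) have "B = 0" by fastforce
  then have "coeff P 0 dvd coeff Q' 0" using AB(1) by (simp add: coeff_mult)
  moreover have "coeff Q' 0 \<in> {-1, 1}" using n(1) Q(2)[of n] by (auto simp: Q'_def coeff_poly_shift)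
  ultimately have "coeff P 0 dvd 1" by auto
  then show False using P0 by auto
qed

lemma garsia_separation:
  assumes \<theta>: "complex_garsia_number \<theta>" and p: "is_min_poly \<theta> p"
    and p0: "coeff p 0 = 2 \<or> coeff p 0 = -2"
  obtains c :: real where "c > 0"
    "\<And>n e. \<lbrakk>\<And>k. k < n \<Longrightarrow> e k \<in> {-1, 0, 1 :: int}; \<exists>k<n. e k \<noteq> 0\<rbrakk> \<Longrightarrow>
       c / 2 ^ n \<le> (norm (\<Sum>k<n. of_int (e k) * (1 / \<theta>) ^ k))\<^sup>2"
proof -
  have ai: "algebraic_integer \<theta>" and conj: "\<And>w. w \<in> galois_conjugates \<theta> \<Longrightarrow> norm w > 1"
    and nonreal: "\<theta> \<notin> \<real>"
    using \<theta> by (auto simp: complex_garsia_number_def garsia_number_def)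
  obtain P where P: "p = map_poly of_int P" "lead_coeff P = 1" using min_poly_integral[OF ai p] .
  have cP: "map_poly of_rat p = (map_poly of_int P :: complex poly)"
    by (simp add: P(1) map_poly_of_rat_of_int)
  have P0: "\<bar>coeff P 0\<bar> = 2"
  proof -
    have "rat_of_int (coeff P 0) = of_int 2 \<or> rat_of_int (coeff P 0) = of_int (-2)"
      using p0 unfolding P(1) by simp
    then show ?thesis unfolding of_int_eq_iff by auto
  qed
  have sf: "rsquarefree (map_poly of_int P :: complex poly)"
    using min_poly_rsquarefree[OF p] cP by simp
  define R where "R = {w :: complex. poly (map_poly of_int P) w = 0}"
  have finR: "finite R" unfolding R_def using P(2) by (intro poly_roots_finite) auto
  have R1: "norm w > 1" if "w \<in> R" for w
    using that p cP by (intro conj) (auto simp: galois_conjugates_def R_def)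
  have \<theta>R: "\<theta> \<in> R" using p cP by (simp add: R_def is_min_poly_def)
  \<comment> \<open>This puts \<open>cnj \<theta>\<close> among the roots and makes the values of
    \<open>Q\<close> at \<open>\<theta>\<close> and \<open>cnj \<theta>\<close> equal in modulus. As
    \<open>\<theta>\<close> is not real, these are two separate factors of the norm, whence the
    square in the bound.\<close>
  have poly_cnj_int: "poly (map_poly of_int q) (cnj w) = cnj (poly (map_poly of_int q) w)" for q w
  proof -
    have "map_poly cnj (map_poly of_int q) = map_poly of_int q" by (intro poly_eqI) (simp add: coeff_map_poly)
    then show ?thesis by (simp add: poly_cnj)
  qed
  have cR: "cnj \<theta> \<in> R" using \<theta>R by (simp add: R_def poly_cnj_int)
  have ne: "cnj \<theta> \<noteq> \<theta>" using nonreal by (simp add: Reals_cnj_iff)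
  define R' where "R' = R - {\<theta>, cnj \<theta>}"
  have split: "(\<Prod>w\<in>R. f w) = f \<theta> * f (cnj \<theta>) * (\<Prod>w\<in>R'. f w)" for f :: "complex \<Rightarrow> real"
  proof -
    have "R = insert \<theta> (insert (cnj \<theta>) R')" using \<theta>R cR by (auto simp: R'_def)
    then have "(\<Prod>w\<in>R. f w) = (\<Prod>w\<in>insert \<theta> (insert (cnj \<theta>) R'). f w)" by simp
    also have "\<dots> = f \<theta> * f (cnj \<theta>) * (\<Prod>w\<in>R'. f w)" using finR ne by (simp add: R'_def)
    finally show ?thesis .
  qed
  have "(\<Prod>z\<in>R. [:-z, 1:]) = (map_poly of_int P :: complex poly)"
    using complex_poly_decompose_rsquarefree[OF sf] P(2) unfolding R_def by simp
  then have "poly (\<Prod>z\<in>R. [:-z, 1:]) 0 = of_int (coeff P 0)" by (simp add: poly_0_coeff_0)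
  then have "norm (\<Prod>z\<in>R. -z) = norm (complex_of_int (coeff P 0))" by (simp add: poly_prod)
  then have prodR: "(\<Prod>w\<in>R. norm w) = 2" using P0 by (simp add: prod_norm[symmetric])
  \<comment> \<open>The geometric series with ratio \<open>1 / norm w\<close>, which bounds the sums
    at the conjugate \<open>w\<close> uniformly in \<open>n\<close>.\<close>
  define K where "K w = 1 / (1 - 1 / norm w)" for w :: complex
  have Kpos: "K w > 0" if "w \<in> R" for w using R1[OF that] by (simp add: K_def divide_less_eq)
  define c where "c = 1 / (\<Prod>w\<in>R'. K w)"
  have c0: "c > 0" unfolding c_def using Kpos by (auto intro!: prod_pos simp: R'_def)
  have "c / 2 ^ n \<le> (norm (\<Sum>k<n. of_int (e k) * (1 / \<theta>) ^ k))\<^sup>2"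
    if e: "\<And>k. k < n \<Longrightarrow> e k \<in> {-1, 0, 1 :: int}" and ex: "\<exists>k<n. e k \<noteq> 0" for n e
  proof -
    \<comment> \<open>Reversed exponents clear the denominators: \<open>Q\<close> at
      \<open>w\<close> is \<open>w ^ n\<close> times the sum in powers of
      \<open>1 / w\<close>.\<close>
    define Q where "Q = (\<Sum>k<n. monom (e k) (n - k))"
    have cQ: "coeff Q j = (if 0 < j \<and> j \<le> n then e (n - j) else 0)" for j
    proof -
      have "coeff Q j = (\<Sum>k<n. if n - k = j then e k else 0)"
        by (simp add: Q_def coeff_sum coeff_monom)
      \<comment> \<open>Truncated subtraction sends every \<open>j > n\<close> to the index 0; the
        inner condition removes these cases.\<close>
      also have "\<dots> = (\<Sum>k<n. if k = n - j then (if 0 < j \<and> j \<le> n then e (n - j) else 0) else 0)"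
        by (intro sum.cong) auto
      also have "\<dots> = (if 0 < j \<and> j \<le> n then e (n - j) else 0)" by (subst sum.delta) auto
      finally show ?thesis .
    qed
    have Q0: "Q \<noteq> 0"
    proof -
      from ex obtain k where "k < n" "e k \<noteq> 0" by blast
      then have "coeff Q (n - k) \<noteq> 0" by (simp add: cQ)
      then show ?thesis by auto
    qed
    have Qc: "coeff Q k \<in> {-1, 0, 1}" for k using e[of "n - k"] by (auto simp: cQ)
    have Qw: "poly (map_poly of_int Q) w = w ^ n * (\<Sum>k<n. of_int (e k) * (1 / w) ^ k)"
      if "w \<noteq> 0" for w :: complex
      using that
      by (simp add: Q_def hom_distribs poly_sum poly_monom sum_distrib_left power_diff power_divide mult_ac)
    have Qle: "norm (poly (map_poly of_int Q) w) \<le> K w * norm w ^ n" if "w \<in> R" for w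
    proof -
      have w: "norm w > 1" "1 / norm w < 1" using R1[OF that] by (auto simp: divide_less_eq)
      have "norm (\<Sum>k<n. of_int (e k) * (1 / w) ^ k) \<le> (\<Sum>k<n. (1 / norm w) ^ k)"
      proof (rule sum_norm_le)
        fix k assume "k \<in> {..<n}"
        then have "norm (complex_of_int (e k)) \<le> 1" using e[of k] by auto
        then show "norm (of_int (e k) * (1 / w) ^ k) \<le> (1 / norm w) ^ k"
          by (simp add: norm_mult norm_power norm_divide mult_left_le_one_le)
      qed
      also have "\<dots> \<le> (\<Sum>k. (1 / norm w) ^ k)"
        using w by (intro sum_le_suminf summable_geometric) auto
      also have "\<dots> = K w" using w by (simp add: K_def suminf_geometric)
      finally have "norm w ^ n * norm (\<Sum>k<n. of_int (e k) * (1 / w) ^ k) \<le> norm w ^ n * K w"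
        by (intro mult_left_mono) auto
      moreover have "w \<noteq> 0" using w(1) by auto
      ultimately show ?thesis by (simp add: Qw norm_mult norm_power mult.commute)
    qed
    have nz: "poly (map_poly of_int Q) w \<noteq> 0" if "w \<in> R" for w
      using poly_nonzero_at_conjugates[of \<theta> P Q w] p P P0 Q0 Qc that by (auto simp: R_def)
    obtain N where N: "(\<Prod>w\<in>R. poly (map_poly of_int Q) w) = of_int N"
      using prod_roots_poly_Ints[OF P(2) sf, of Q] unfolding R_def by (auto elim: Ints_cases)
    have "N \<noteq> 0"
    proof
      assume "N = 0"
      then have "(\<Prod>w\<in>R. poly (map_poly of_int Q) w) = 0" using N by simp
      then show False using nz finR by (auto simp: prod_zero_iff)
    qed
    then have "1 \<le> norm (complex_of_int N)" by simp
    also have "\<dots> = (\<Prod>w\<in>R. norm (poly (map_poly of_int Q) w))" by (simp add: N[symmetric] prod_norm)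
    also have "\<dots> = (norm (poly (map_poly of_int Q) \<theta>))\<^sup>2 * (\<Prod>w\<in>R'. norm (poly (map_poly of_int Q) w))"
      unfolding split by (simp add: poly_cnj_int power2_eq_square)
    also have "\<dots> \<le> (norm (poly (map_poly of_int Q) \<theta>))\<^sup>2 * (\<Prod>w\<in>R'. K w * norm w ^ n)"
      by (intro mult_left_mono prod_mono) (auto simp: R'_def intro: Qle)
    \<comment> \<open>The powers pulled out of \<open>Q\<close> at \<open>\<theta>\<close> and
      \<open>cnj \<theta>\<close> complete the product of all conjugates, so the growth is exactly
      \<open>2 ^ n\<close>.\<close>
    also have "\<dots> = (norm (\<Sum>k<n. of_int (e k) * (1 / \<theta>) ^ k))\<^sup>2 * (\<Prod>w\<in>R'. K w)
                     * (norm \<theta> * norm (cnj \<theta>) * (\<Prod>w\<in>R'. norm w)) ^ n"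
      using R1[OF \<theta>R] by (subst Qw)
        (auto simp: norm_mult norm_power prod.distrib prod_power_distrib power_mult_distrib power2_eq_square)
    also have "norm \<theta> * norm (cnj \<theta>) * (\<Prod>w\<in>R'. norm w) = 2"
      using prodR unfolding split .
    finally have "1 \<le> (norm (\<Sum>k<n. of_int (e k) * (1 / \<theta>) ^ k))\<^sup>2 / c * 2 ^ n"
      by (simp add: c_def)
    then show ?thesis using c0 by (simp add: field_simps)
  qed
  then show ?thesis using that c0 by blast
qed

subsection \<open>From separation to a bounded density\<close>

text \<open>Domination bounds the Radon-Nikodym density almost everywhere; replacing it by its
  minimum with a constant yields a bound at every point without changing the measure.\<close>

lemma (in sigma_finite_measure) bounded_density_of_emeasure_le:
  assumes N: "finite_measure N" "sets N = sets M" and C: "C > (0 :: real)"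
    and le: "\<And>A. A \<in> sets M \<Longrightarrow> emeasure N A \<le> ennreal C * emeasure M A"
  shows "absolutely_continuous M N \<and>
    (\<exists>f. f \<in> borel_measurable M \<and> (\<exists>B :: real. \<forall>x. f x \<le> ennreal B) \<and> N = density M f)"
proof -
  interpret N: finite_measure N by fact
  have ac: "absolutely_continuous M N"
    unfolding absolutely_continuous_def
  proof
    fix A assume "A \<in> null_sets M"
    then have "A \<in> sets M" "emeasure M A = 0" by auto
    with le[of A] show "A \<in> null_sets N" using N(2) by (auto simp: null_sets_def)
  qed
  obtain f where f: "f \<in> borel_measurable M" "density M f = N"
    using Radon_Nikodym[OF ac N(2)] by blast
  \<comment> \<open>Cutting at \<open>2 * C\<close> instead of \<open>C\<close> makes the exceptional set of finite measure, hence null.\<close>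
  define A where "A = {x \<in> space M. f x > ennreal (2 * C)}"
  have A: "A \<in> sets M" unfolding A_def using f(1) by measurable
  have "ennreal (2 * C) * emeasure M A = (\<integral>\<^sup>+x. ennreal (2 * C) * indicator A x \<partial>M)"
    using A by (simp add: nn_integral_cmult_indicator)
  also have "\<dots> \<le> (\<integral>\<^sup>+x. f x * indicator A x \<partial>M)"
    by (intro nn_integral_mono) (auto simp: A_def split: split_indicator)
  also have "\<dots> = emeasure N A" using f A by (auto simp: emeasure_density)
  finally have ge: "ennreal (2 * C) * emeasure M A \<le> emeasure N A" .
  have "emeasure M A = 0"
  proof (rule ccontr)
    assume nz: "emeasure M A \<noteq> 0"
    have "ennreal (2 * C) * emeasure M A < \<infinity>"
      using ge N.emeasure_finite[of A] by (metis infinity_ennreal_def less_top order_le_less_trans)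
    then have "emeasure M A \<noteq> \<infinity>" using C by (auto simp: ennreal_mult_top)
    then obtain a where a: "emeasure M A = ennreal a" "a \<ge> 0" by (cases "emeasure M A") auto
    have "ennreal (2 * C) * ennreal a \<le> ennreal C * ennreal a" using ge le[OF A] a by simp
    then have "2 * C * a \<le> C * a" using C a by (simp add: ennreal_mult[symmetric] ennreal_le_iff)
    then have "a = 0" using C a(2) by (simp add: mult_le_0_iff)
    then show False using nz a by simp
  qed
  then have AE: "AE x in M. f x \<le> ennreal (2 * C)"
    using A by (intro AE_I[of _ _ A]) (auto simp: A_def)
  define g where "g x = min (f x) (ennreal (2 * C))" for x
  have g: "g \<in> borel_measurable M" unfolding g_def using f(1) by measurable
  have "density M g = density M f"
    using f(1) g AE by (intro density_cong) (auto simp: g_def)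
  then show ?thesis using ac g f(2) by (intro conjI exI[of _ g] exI[of _ "2 * C"]) (auto simp: g_def)
qed

text \<open>Packing bound: balls of half the separation are disjoint, so their volumes add up inside
  \<open>U\<close>.\<close>

lemma card_separated_le_emeasure:
  fixes x :: "'i \<Rightarrow> 'a :: euclidean_space"
  assumes fin: "finite W" and r: "r \<ge> 0" and U: "U \<in> sets borel"
    and sub: "\<And>i. i \<in> W \<Longrightarrow> ball (x i) r \<subseteq> U"
    and sep: "\<And>i j. i \<in> W \<Longrightarrow> j \<in> W \<Longrightarrow> i \<noteq> j \<Longrightarrow> dist (x i) (x j) \<ge> 2 * r"
  shows "of_nat (card W) * ennreal (unit_ball_vol DIM('a) * r ^ DIM('a)) \<le> emeasure lborel U"
proof -
  have "disjoint_family_on (\<lambda>i. ball (x i) r) W"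
    unfolding disjoint_family_on_def
  proof (intro ballI impI)
    fix i j assume "i \<in> W" "j \<in> W" "i \<noteq> j"
    then have "dist (x i) (x j) \<ge> 2 * r" by (rule sep)
    then show "ball (x i) r \<inter> ball (x j) r = {}" by (intro disjoint_ballI) auto
  qed
  then have "(\<Sum>i\<in>W. emeasure lborel (ball (x i) r)) = emeasure lborel (\<Union>i\<in>W. ball (x i) r)"
    using fin by (intro sum_emeasure) auto
  also have "\<dots> \<le> emeasure lborel U" using sub U by (intro emeasure_mono) auto
  finally show ?thesis using r by (simp add: emeasure_ball)
qed

section \<open>Cylinders in the coin-tossing space\<close>

lemma space_sign_space [simp]: "space sign_space = UNIV"
  by (simp add: sign_space_def space_PiM)

lemma prob_space_sign_space: "prob_space sign_space"
  unfolding sign_space_def by (intro prob_space_PiM measure_pmf.prob_space_axioms)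

lemma emeasure_sign_space_cylinder:
  "emeasure sign_space {\<omega>. \<forall>k<n. \<omega> k = w k} = ennreal (1 / 2 ^ n)"
proof -
  interpret product_prob_space "\<lambda>_ :: nat. measure_pmf (bernoulli_pmf (1/2))" UNIV
    by unfold_locales
  have "emeasure sign_space {\<omega>. \<forall>k<n. \<omega> k = w k} =
      (\<Prod>k<n. emeasure (measure_pmf (bernoulli_pmf (1/2))) {w k})"
    using emeasure_PiM_Collect[of "{..<n}" "\<lambda>k. {w k}"] unfolding sign_space_def
    by (simp add: space_PiM Ball_def)
  also have "\<dots> = (\<Prod>k<n. ennreal (1 / 2))"
    by (intro prod.cong refl) (simp add: emeasure_pmf_single pmf_bernoulli_half)
  also have "\<dots> = ennreal (1 / 2 ^ n)"
    by (subst prod_ennreal) (simp_all add: power_one_over)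
  finally show ?thesis .
qed

lemma sets_sign_space_cylinder [measurable]:
  "{\<omega>. \<forall>k<n. \<omega> k = w k} \<in> sets sign_space"
proof (rule ccontr)
  assume "{\<omega>. \<forall>k<n. \<omega> k = w k} \<notin> sets sign_space"
  \<comment> \<open>Non-measurable sets have \<open>emeasure\<close> 0 by convention, against the
    positive value just computed.\<close>
  then have "emeasure sign_space {\<omega>. \<forall>k<n. \<omega> k = w k} = 0" by (rule emeasure_notin_sets)
  then show False unfolding emeasure_sign_space_cylinder by simp
qed

text \<open>Extensional functions on \<open>{..<n}\<close> represent the finite words. Intersecting
  with them leaves a finite union, even though \<open>W\<close> may be infinite.\<close>

lemma restrict_in_eq_UN_cylinders:
  "{\<omega> :: nat \<Rightarrow> bool. restrict \<omega> {..<n} \<in> W} =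
     (\<Union>w \<in> W \<inter> (\<Pi>\<^sub>E k\<in>{..<n}. UNIV). {\<omega>. \<forall>k<n. \<omega> k = w k})"
proof (intro equalityI subsetI)
  fix \<omega> :: "nat \<Rightarrow> bool" assume "\<omega> \<in> {\<omega>. restrict \<omega> {..<n} \<in> W}"
  then have "restrict \<omega> {..<n} \<in> W \<inter> (\<Pi>\<^sub>E k\<in>{..<n}. UNIV)" by auto
  then show "\<omega> \<in> (\<Union>w \<in> W \<inter> (\<Pi>\<^sub>E k\<in>{..<n}. UNIV). {\<omega>. \<forall>k<n. \<omega> k = w k})" by (rule UN_I) simp
next
  fix \<omega> :: "nat \<Rightarrow> bool"
  assume "\<omega> \<in> (\<Union>w \<in> W \<inter> (\<Pi>\<^sub>E k\<in>{..<n}. UNIV). {\<omega>. \<forall>k<n. \<omega> k = w k})"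
  then obtain w where w: "w \<in> W" "w \<in> (\<Pi>\<^sub>E k\<in>{..<n}. UNIV)" "\<forall>k<n. \<omega> k = w k" by auto
  then have "restrict \<omega> {..<n} = w" by (auto simp: PiE_def extensional_def fun_eq_iff)
  then show "\<omega> \<in> {\<omega>. restrict \<omega> {..<n} \<in> W}" using w(1) by simp
qed

lemma finite_sign_words: "finite (W \<inter> (\<Pi>\<^sub>E k\<in>{..<n :: nat}. UNIV :: bool set))"
  by (intro finite_Int disjI2 finite_PiE) auto

lemma sets_sign_space_restrict: "{\<omega>. restrict \<omega> {..<n} \<in> W} \<in> sets sign_space"
  unfolding restrict_in_eq_UN_cylinders
  using finite_sign_words by (intro sets.finite_UN sets_sign_space_cylinder) auto

lemma emeasure_sign_space_restrict_le:
  "emeasure sign_space {\<omega>. restrict \<omega> {..<n} \<in> W}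
     \<le> of_nat (card (W \<inter> (\<Pi>\<^sub>E k\<in>{..<n}. UNIV))) * ennreal (1 / 2 ^ n)"
proof -
  have "emeasure sign_space {\<omega>. restrict \<omega> {..<n} \<in> W}
      \<le> (\<Sum>w \<in> W \<inter> (\<Pi>\<^sub>E k\<in>{..<n}. UNIV). emeasure sign_space {\<omega>. \<forall>k<n. \<omega> k = w k})"
    unfolding restrict_in_eq_UN_cylinders
    using finite_sign_words by (intro emeasure_subadditive_finite) auto
  then show ?thesis by (simp add: emeasure_sign_space_cylinder)
qed

section \<open>The random series and its law\<close>

lemma norm_sgn_of [simp]: "norm (sgn_of b) = 1"
  by (simp add: sgn_of_def)

lemma summable_norm_sgn_of:
  assumes "norm l < 1"
  shows "summable (\<lambda>n. norm (sgn_of (\<omega> n) * l ^ n))"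
  using assms by (simp add: norm_mult norm_power summable_geometric)

lemma measurable_sign_series [measurable]:
  "(\<lambda>\<omega>. \<Sum>n. sgn_of (\<omega> n) * l ^ n) \<in> borel_measurable sign_space"
proof -
  have [measurable]: "(\<lambda>\<omega>. sgn_of (\<omega> n)) \<in> borel_measurable sign_space" for n
  proof -
    have "(\<lambda>\<omega>. \<omega> n) \<in> measurable sign_space (measure_pmf (bernoulli_pmf (1/2)))"
      unfolding sign_space_def by (rule measurable_component_singleton) simp
    from measurable_compose[OF this, of sgn_of borel] show ?thesis by simp
  qed
  show ?thesis by measurable
qed

lemma dist_sign_series_partial_sum:
  assumes l: "norm l < 1"
  shows "dist (\<Sum>k. sgn_of (\<omega> k) * l ^ k) (\<Sum>k<n. sgn_of (\<omega> k) * l ^ k) \<le> norm l ^ n / (1 - norm l)"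
proof -
  have s: "summable (\<lambda>k. sgn_of (\<omega> k) * l ^ k)" for \<omega>
    using summable_norm_sgn_of[OF l] by (rule summable_norm_cancel)
  have sn: "summable (\<lambda>k. norm (sgn_of (\<omega> (k + n)) * l ^ (k + n)))"
    using summable_norm_sgn_of[OF l, of \<omega>] by (subst summable_iff_shift)
  have "(\<Sum>k. sgn_of (\<omega> k) * l ^ k) - (\<Sum>k<n. sgn_of (\<omega> k) * l ^ k)
      = (\<Sum>k. sgn_of (\<omega> (k + n)) * l ^ (k + n))"
    using suminf_split_initial_segment[OF s, of \<omega> n] by simp
  also have "norm \<dots> \<le> (\<Sum>k. norm (sgn_of (\<omega> (k + n)) * l ^ (k + n)))"
    by (rule summable_norm[OF sn])
  also have "\<dots> = (\<Sum>k. norm l ^ n * norm l ^ k)"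
    by (simp add: norm_mult norm_power power_add mult.commute)
  also have "\<dots> = norm l ^ n / (1 - norm l)"
    using l by (simp add: suminf_mult summable_geometric suminf_geometric)
  finally show ?thesis by (simp add: dist_norm)
qed

lemma nu_compact_le:
  assumes l: "norm l < 1" and c: "c > 0"
    and sep: "\<And>n w w'. \<lbrakk>w \<in> (\<Pi>\<^sub>E k\<in>{..<n}. UNIV); w' \<in> (\<Pi>\<^sub>E k\<in>{..<n}. UNIV); w \<noteq> w'\<rbrakk> \<Longrightarrow>
       c / 2 ^ n \<le> (dist (\<Sum>k<n. sgn_of (w k) * l ^ k) (\<Sum>k<n. sgn_of (w' k) * l ^ k))\<^sup>2"
    and K: "compact K"
  shows "emeasure (nu l) K \<le> ennreal (4 / (pi * c)) * emeasure lborel K"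
proof (cases "K = {}")
  \<comment> \<open>By convention \<open>infdist y {}\<close> is 0, so for the empty set the
    neighbourhoods below would be the whole plane.\<close>
  case False
  define S where "S n w = (\<Sum>k<n. sgn_of (w k) * l ^ k)" for n and w :: "nat \<Rightarrow> bool"
  define N where "N e = {y. infdist y K \<le> e}" for e
  have closedN: "closed (N e)" for e
    unfolding N_def by (intro closed_Collect_le continuous_intros)
  \<comment> \<open>One \<open>e\<close> absorbs the tail of the series, the other the radius of the
    discs.\<close>
  have main: "emeasure (nu l) K \<le> ennreal (4 / (pi * c)) * emeasure lborel (N (2 * e))" if "e > 0" for e
  proof -
    have "(\<lambda>n. norm l ^ n / (1 - norm l)) \<longlonglongrightarrow> 0 / (1 - norm l)"
      using l by (intro tendsto_intros LIMSEQ_power_zero) auto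
    then have ev1: "eventually (\<lambda>n. norm l ^ n / (1 - norm l) < e) sequentially"
      using that by (intro order_tendstoD(2)) auto
    have "(\<lambda>n. sqrt (c * (1 / 2) ^ n) / 2) \<longlonglongrightarrow> sqrt (c * 0) / 2"
      by (intro tendsto_intros LIMSEQ_power_zero) auto
    then have ev2: "eventually (\<lambda>n. sqrt (c * (1 / 2) ^ n) / 2 < e) sequentially"
      using that by (intro order_tendstoD(2)) auto
    obtain n where n: "norm l ^ n / (1 - norm l) < e" "sqrt (c * (1 / 2) ^ n) / 2 < e"
      using eventually_happens'[OF _ eventually_conj[OF ev1 ev2]] by auto
    \<comment> \<open>Half the separation. A disc then has area \<open>pi * c / (4 * 2 ^ n)\<close>,
      so the probability \<open>1 / 2 ^ n\<close> of a word is \<open>4 / (pi * c)\<close> times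
      this area, for every \<open>n\<close>.\<close>
    define r where "r = sqrt (c / 2 ^ n) / 2"
    have r: "r \<ge> 0" "r < e" "r ^ 2 = c / (4 * 2 ^ n)"
      using n c by (auto simp: r_def power_one_over field_simps power_divide)
    define W where "W = {w. S n w \<in> N e}"
    define W' where "W' = W \<inter> (\<Pi>\<^sub>E k\<in>{..<n}. UNIV)"
    have fin: "finite W'" unfolding W'_def by (rule finite_sign_words)
    have card: "of_nat (card W') * ennreal (unit_ball_vol DIM(complex) * r ^ DIM(complex))
        \<le> emeasure lborel (N (2 * e))"
    proof (rule card_separated_le_emeasure[OF fin r(1), where x = "S n"])
      fix w assume "w \<in> W'"
      then have w: "infdist (S n w) K \<le> e" by (auto simp: W'_def W_def N_def)
      show "ball (S n w) r \<subseteq> N (2 * e)"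
      proof
        fix y assume "y \<in> ball (S n w) r"
        then show "y \<in> N (2 * e)"
          using infdist_triangle[of y K "S n w"] w r(2) by (simp add: N_def dist_commute)
      qed
    next
      fix w w' assume "w \<in> W'" "w' \<in> W'" "w \<noteq> w'"
      then have "c / 2 ^ n \<le> (dist (S n w) (S n w'))\<^sup>2"
        using sep[of w n w'] by (auto simp: W'_def S_def)
      then have "sqrt (c / 2 ^ n) \<le> dist (S n w) (S n w')" by (rule real_le_lsqrt[rotated 1]) (use c in auto)
      then show "2 * r \<le> dist (S n w) (S n w')" by (simp add: r_def)
    qed (use closedN in auto)
    have "emeasure (nu l) K = emeasure sign_space {\<omega>. (\<Sum>k. sgn_of (\<omega> k) * l ^ k) \<in> K}"
      unfolding nu_def using K
      by (subst emeasure_distr) (auto simp: vimage_def intro: borel_closed compact_imp_closed)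
    also have "\<dots> \<le> emeasure sign_space {\<omega>. restrict \<omega> {..<n} \<in> W}"
    proof (rule emeasure_mono)
      show "{\<omega>. (\<Sum>k. sgn_of (\<omega> k) * l ^ k) \<in> K} \<subseteq> {\<omega>. restrict \<omega> {..<n} \<in> W}"
      proof safe
        fix \<omega> :: "nat \<Rightarrow> bool" assume "(\<Sum>k. sgn_of (\<omega> k) * l ^ k) \<in> K"
        then have "infdist (S n \<omega>) K \<le> dist (S n \<omega>) (\<Sum>k. sgn_of (\<omega> k) * l ^ k)" by (rule infdist_le)
        also have "\<dots> \<le> e" using dist_sign_series_partial_sum[OF l, of \<omega> n] n(1) by (simp add: dist_commute S_def)
        \<comment> \<open>\<open>S n\<close> reads only the first \<open>n\<close> signs, so
          restricting leaves it unchanged.\<close>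
        finally show "restrict \<omega> {..<n} \<in> W" by (simp add: W_def N_def S_def)
      qed
    qed (rule sets_sign_space_restrict)
    also have "\<dots> \<le> of_nat (card W') * ennreal (1 / 2 ^ n)"
      unfolding W'_def by (rule emeasure_sign_space_restrict_le)
    also have "\<dots> = ennreal (4 / (pi * c)) * (of_nat (card W') * ennreal (unit_ball_vol DIM(complex) * r ^ DIM(complex)))"
      using c by (simp add: r(3) unit_ball_vol_2 ennreal_mult[symmetric] ennreal_of_nat_eq_real_of_nat field_simps)
    also have "\<dots> \<le> ennreal (4 / (pi * c)) * emeasure lborel (N (2 * e))"
      by (intro mult_left_mono card) auto
    finally show ?thesis .
  qed
  have Keq: "K = (\<Inter>m. N (2 * (1 / real (Suc m))))"
  proof
    show "K \<subseteq> (\<Inter>m. N (2 * (1 / real (Suc m))))" by (auto simp: N_def)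
    show "(\<Inter>m. N (2 * (1 / real (Suc m)))) \<subseteq> K"
    proof
      fix y assume "y \<in> (\<Inter>m. N (2 * (1 / real (Suc m))))"
      then have le: "infdist y K \<le> 2 * (1 / real (Suc m))" for m by (auto simp: N_def)
      have "(\<lambda>m. 2 * (1 / real (Suc m))) \<longlonglongrightarrow> 2 * 0"
        by (intro tendsto_intros LIMSEQ_Suc[OF lim_1_over_n])
      then have "infdist y K \<le> 2 * 0" using le by (intro LIMSEQ_le_const) auto
      then have "infdist y K = 0" using infdist_nonneg[of y K] by simp
      then show "y \<in> K" using in_closed_iff_infdist_zero[OF compact_imp_closed[OF K] False] by simp
    qed
  qed
  have "(\<lambda>m. emeasure lborel (N (2 * (1 / real (Suc m)))))
      \<longlonglongrightarrow> emeasure lborel (\<Inter>m. N (2 * (1 / real (Suc m))))"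
  proof (rule Lim_emeasure_decseq)
    show "decseq (\<lambda>m. N (2 * (1 / real (Suc m))))"
      by (auto simp: decseq_def N_def elim!: order_trans intro!: divide_left_mono)
    fix m
    \<comment> \<open>Continuity from above needs finite areas, which compactness of the
      neighbourhoods provides.\<close>
    have "compact (N (2 * (1 / real (Suc m))))"
      unfolding N_def using K False by (intro compact_infdist_le) auto
    then show "emeasure lborel (N (2 * (1 / real (Suc m)))) \<noteq> \<infinity>"
      using emeasure_bounded_finite[OF compact_imp_bounded] by (metis infinity_ennreal_def less_irrefl)
  qed (use closedN in auto)
  then have "(\<lambda>m. ennreal (4 / (pi * c)) * emeasure lborel (N (2 * (1 / real (Suc m)))))
      \<longlonglongrightarrow> ennreal (4 / (pi * c)) * emeasure lborel K"
    unfolding Keq[symmetric] by (intro ennreal_tendsto_cmult) auto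
  then show ?thesis by (rule LIMSEQ_le_const) (intro exI allI impI main, simp)
qed simp

lemma nu_le:
  assumes "norm l < 1" and "c > 0"
    and "\<And>n w w'. \<lbrakk>w \<in> (\<Pi>\<^sub>E k\<in>{..<n}. UNIV); w' \<in> (\<Pi>\<^sub>E k\<in>{..<n}. UNIV); w \<noteq> w'\<rbrakk> \<Longrightarrow>
       c / 2 ^ n \<le> (dist (\<Sum>k<n. sgn_of (w k) * l ^ k) (\<Sum>k<n. sgn_of (w' k) * l ^ k))\<^sup>2"
    and A: "A \<in> sets borel"
  shows "emeasure (nu l) A \<le> ennreal (4 / (pi * c)) * emeasure lborel A"
proof -
  interpret sign: prob_space sign_space by (rule prob_space_sign_space)
  interpret prob_space "nu l" unfolding nu_def by (rule sign.prob_space_distr) measurable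
  have "emeasure (nu l) A = (SUP K \<in> {K. K \<subseteq> A \<and> compact K}. emeasure (nu l) K)"
    using A by (intro inner_regular) (use emeasure_finite[of UNIV] in \<open>auto simp: nu_def\<close>)
  also have "\<dots> \<le> ennreal (4 / (pi * c)) * emeasure lborel A"
  proof (rule SUP_least, safe)
    fix K assume K: "K \<subseteq> A" "compact K"
    have "emeasure (nu l) K \<le> ennreal (4 / (pi * c)) * emeasure lborel K"
      using nu_compact_le[OF assms(1-3) K(2)] by blast
    also have "\<dots> \<le> ennreal (4 / (pi * c)) * emeasure lborel A"
      using K A by (intro mult_left_mono emeasure_mono) auto
    finally show "emeasure (nu l) K \<le> ennreal (4 / (pi * c)) * emeasure lborel A" .
  qed
  finally show ?thesis .
qed

theorem mainTheorem9:
  fixes \<theta> :: complex and p :: "rat poly"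
  assumes "complex_garsia_number \<theta>"
    and "is_min_poly \<theta> p"
    and "coeff p 0 = 2 \<or> coeff p 0 = -2"
  shows "absolutely_continuous lborel (nu (1 / \<theta>)) \<and>
         (\<exists>f :: complex \<Rightarrow> ennreal. f \<in> borel_measurable lborel \<and>
            (\<exists>C :: real. \<forall>x. f x \<le> ennreal C) \<and>
            nu (1 / \<theta>) = density lborel f)"
proof -
  obtain c where c: "c > 0" "\<And>n e. \<lbrakk>\<And>k. k < n \<Longrightarrow> e k \<in> {-1, 0, 1 :: int}; \<exists>k<n. e k \<noteq> 0\<rbrakk> \<Longrightarrow>
       c / 2 ^ n \<le> (norm (\<Sum>k<n. of_int (e k) * (1 / \<theta>) ^ k))\<^sup>2"
    using garsia_separation[OF assms] by blast
  have l: "norm (1 / \<theta>) < 1"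
    using assms(1) by (simp add: complex_garsia_number_def garsia_number_def norm_divide divide_less_eq)
  have sep: "c / 2 ^ n \<le> (dist (\<Sum>k<n. sgn_of (w k) * (1 / \<theta>) ^ k) (\<Sum>k<n. sgn_of (w' k) * (1 / \<theta>) ^ k))\<^sup>2"
    if w: "w \<in> (\<Pi>\<^sub>E k\<in>{..<n}. UNIV)" "w' \<in> (\<Pi>\<^sub>E k\<in>{..<n}. UNIV)" "w \<noteq> w'" for n w w'
  proof -
    \<comment> \<open>Half the difference of the two signs; the factor 2 is dropped afterwards,
      since it only enlarges the distance.\<close>
    define e where "e k = (if w k = w' k then 0 else if w k then 1 else -1 :: int)" for k
    \<comment> \<open>Extensional words that differ must differ below \<open>n\<close>.\<close>
    have "\<exists>k<n. w k \<noteq> w' k" using w PiE_ext[of w "{..<n}" _ w'] by blast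
    then have "c / 2 ^ n \<le> (norm (\<Sum>k<n. of_int (e k) * (1 / \<theta>) ^ k))\<^sup>2"
      by (intro c(2)) (auto simp: e_def)
    also have "\<dots> \<le> (norm (2 * (\<Sum>k<n. of_int (e k) * (1 / \<theta>) ^ k)))\<^sup>2"
      by (intro power_mono) (auto simp: norm_mult)
    also have "2 * (\<Sum>k<n. of_int (e k) * (1 / \<theta>) ^ k) =
        (\<Sum>k<n. sgn_of (w k) * (1 / \<theta>) ^ k) - (\<Sum>k<n. sgn_of (w' k) * (1 / \<theta>) ^ k)"
      unfolding sum_distrib_left sum_subtractf[symmetric]
      by (intro sum.cong) (auto simp: e_def sgn_of_def)
    finally show ?thesis by (simp add: dist_norm)
  qed
  interpret sign: prob_space sign_space by (rule prob_space_sign_space)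
  interpret prob_space "nu (1 / \<theta>)" unfolding nu_def by (rule sign.prob_space_distr) measurable
  show ?thesis
  proof (rule lborel.bounded_density_of_emeasure_le[where C = "4 / (pi * c)"])
    show "finite_measure (nu (1 / \<theta>))" by unfold_locales
    show "emeasure (nu (1 / \<theta>)) A \<le> ennreal (4 / (pi * c)) * emeasure lborel A"
      if "A \<in> sets lborel" for A
      by (rule nu_le[OF l c(1)], rule sep) (use that in simp_all)
  qed (use c(1) in \<open>auto simp: nu_def\<close>)
qed

end
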